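(* Let $1<p\le q<\infty$, let $b_j,c_j\in\mathbb{R}$ for $j=0,1,2$ with $b_1-b_2=c_1-c_2>0$, and let $K:(0,\infty)\times(0,\infty)\to\mathbb{C}$ be a measurable kernel with $$|K(x,y)|\lesssim\min\{x^{b_1}y^{c_1},x^{b_2}y^{c_2}\},\qquad x,y>0.$$ Let $$Ff(y)=y^{c_0}\int_0^\infty x^{b_0}f(x)K(x,y)\,dx,\qquad y>0.$$ If $\beta,\gamma\in\mathbb{R}$ satisfy $$\beta=\gamma+c_0-b_0+c_1-b_1+\frac1q-\frac1{p'},\qquad \frac1q+c_0+c_2<\beta<\frac1q+c_0+c_1,$$ then the inequality $$\Vert y^{-\beta}Ff\Vert_q\lesssim\Vert x^\gamma f\Vert_p$$ holds for every measurable $f$ (for which $Ff$ is defined, see context), with a constant independent of $f$.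
   Context: Notation: $p'=p/(p-1)$; $\Vert g\Vert_p=\big(\int_0^\infty|g(x)|^p\,dx\big)^{1/p}$. $A\lesssim B$ means $A\le cB$ with $c>0$ independent of $x,y,f$. Functions $f$: $f:(0,\infty)\to\mathbb{C}$ is measurable with $\int_0^1x^{b_0+b_1}|f(x)|\,dx+\int_1^\infty x^{b_0+b_2}|f(x)|\,dx<\infty$, so that $Ff(y)$ is well defined for every $y>0$. *)

theory Defs
  imports "HOL-Analysis.Analysis"
begin

definition conj_exponent :: "real \<Rightarrow> real" where
  "conj_exponent p = p / (p - 1)"

(* The norm takes the value infinity if the p-th power is not integrable; powr is not
   available on ennreal, hence the case distinction. *)
definition Lp_norm :: "real \<Rightarrow> (real \<Rightarrow> complex) \<Rightarrow> ennreal" where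
  "Lp_norm p g =
     (let I = (\<integral>\<^sup>+x\<in>{0<..}. ennreal (norm (g x) powr p) \<partial>lebesgue)
      in if I = \<infinity> then \<infinity> else ennreal (enn2real I powr (1 / p)))"

definition kernel_op ::
  "real \<Rightarrow> real \<Rightarrow> (real \<Rightarrow> real \<Rightarrow> complex) \<Rightarrow> (real \<Rightarrow> complex) \<Rightarrow> real \<Rightarrow> complex" where
  "kernel_op b0 c0 K f y =
     of_real (y powr c0) * (LINT x:{0<..}|lebesgue. of_real (x powr b0) * f x * K x y)"

(* For a kernel bounded by a multiple of min (x^b1 y^c1) (x^b2 y^c2), the last conjunct makes
   the integral in kernel_op absolutely convergent. *)
definition admissible :: "real \<Rightarrow> real \<Rightarrow> real \<Rightarrow> (real \<Rightarrow> complex) \<Rightarrow> bool" where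
  "admissible b0 b1 b2 f \<longleftrightarrow>
     set_borel_measurable lebesgue {0<..} f \<and>
     (\<integral>\<^sup>+x\<in>{0<..<1}. ennreal (x powr (b0 + b1) * norm (f x)) \<partial>lebesgue) +
     (\<integral>\<^sup>+x\<in>{1<..}. ennreal (x powr (b0 + b2) * norm (f x)) \<partial>lebesgue) < \<infinity>"

end

theory Submission
  imports Defs
begin

text \<open>
  The weights are chosen so that the operator becomes a convolution on the multiplicative group of
  positive reals. Put \<open>G x = x powr (1/p + \<gamma>) * norm (f x)\<close> and
  \<open>H y = y powr (1/q - \<beta>) * norm (Ff y)\<close>. With respect to the Haar measure \<open>dx / x\<close>, the \<open>L\<^sup>p\<close> norm of
  \<open>G\<close> is the norm of \<open>x powr \<gamma> * f x\<close>, and the \<open>L\<^sup>q\<close> norm of \<open>H\<close> is the norm of \<open>y powr - \<beta> * Ff y\<close>.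
  The relation between \<open>\<beta>\<close> and \<open>\<gamma>\<close> is exactly what makes the weighted kernel bound depend on the product
  \<open>x * y\<close> alone (\<open>kernel_weight_identity\<close>): up to a constant, \<open>H y\<close> is at most the integral of
  \<open>\<phi> (x * y) * G x\<close> against \<open>dx / x\<close>, where \<open>\<phi> t = min (t powr s) (t powr - r)\<close> with
  \<open>s = 1/q + c0 + c1 - \<beta>\<close> and \<open>r = \<beta> - (1/q + c0 + c2)\<close>. The two strict inequalities
  for \<open>\<beta>\<close> say that \<open>s\<close> and \<open>r\<close> are positive, hence that \<open>\<phi> \<le> 1\<close> and that \<open>\<phi>\<close> has finite integral
  \<open>I = 1/s + 1/r\<close> against \<open>dt / t\<close>; by invariance the same integral is obtained for
  \<open>x \<mapsto> \<phi> (x * y)\<close> and \<open>y \<mapsto> \<phi> (x * y)\<close>.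

  What remains is a case of Young's convolution inequality, proved here as a Schur test
  (\<open>schur_Lp_Lq\<close>). Jensen's inequality bounds the \<open>p\<close>-th power of the convolution at \<open>y\<close> by
  \<open>I powr (p - 1) * J y\<close>, where \<open>J y\<close> integrates \<open>\<phi> (x * y) * G x powr p\<close>. Here
  \<open>J\<close> is bounded by the integral \<open>A\<close> of \<open>G powr p\<close> because \<open>\<phi> \<le> 1\<close>, and its integral is at most \<open>I * A\<close>
  by Tonelli. A function that is both bounded and integrable has an integrable power \<open>q/p \<ge> 1\<close>,
  which is the claim.
\<close>

section \<open>A Schur test from \<open>L\<^sup>p\<close> to \<open>L\<^sup>q\<close> for bounded kernels\<close>

text \<open>
  The graph of \<open>a \<mapsto> a powr p\<close> lies above its tangent at \<open>v\<close>. Multiplied out, this is Young's inequality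
  for \<open>a\<close> and \<open>v powr (p - 1)\<close>.
\<close>

lemma powr_tangent_le:
  fixes a v p :: real
  assumes "1 < p" "0 \<le> a" "0 \<le> v"
  shows "p * v powr (p - 1) * a \<le> a powr p + (p - 1) * v powr p"
proof -
  have "a * v powr (p - 1) \<le> a powr p / p + (v powr (p - 1)) powr (p / (p - 1)) / (p / (p - 1))"
    using assms by (intro Youngs_inequality) (auto simp: field_simps)
  also have "(v powr (p - 1)) powr (p / (p - 1)) = v powr p"
    using assms by (simp add: powr_powr)
  finally have "p * (a * v powr (p - 1)) \<le> p * (a powr p / p + v powr p / (p / (p - 1)))"
    using assms by (intro mult_left_mono) auto
  moreover have "p * (a powr p / p + v powr p / (p / (p - 1))) = a powr p + (p - 1) * v powr p"
    using assms by (simp add: field_simps)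
  ultimately show ?thesis
    by (simp add: mult_ac)
qed

text \<open>
  Jensen's inequality for the weight \<open>k\<close>, which need not have total mass 1. Integrating the tangent
  inequality bounds the integral \<open>h\<close> of \<open>k * G\<close> for every choice of the point of tangency \<open>v\<close>: \<open>v = 1\<close> shows
  that \<open>h\<close> is finite, and then the best choice, \<open>v = h / I\<close>, gives the bound.
\<close>

lemma nn_integral_weighted_power_mean:
  fixes k G :: "'a \<Rightarrow> real" and p I J :: real
  assumes p: "1 < p" and [measurable]: "k \<in> borel_measurable M" "G \<in> borel_measurable M"
    and nonneg: "\<And>x. 0 \<le> k x" "\<And>x. 0 \<le> G x"
    and I: "0 < I" "(\<integral>\<^sup>+x. ennreal (k x) \<partial>M) \<le> ennreal I"
    and J: "0 \<le> J" "(\<integral>\<^sup>+x. ennreal (k x * G x powr p) \<partial>M) \<le> ennreal J"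
  shows "\<exists>h\<ge>0. (\<integral>\<^sup>+x. ennreal (k x * G x) \<partial>M) = ennreal h \<and> h powr p \<le> I powr (p - 1) * J"
proof -
  let ?H = "\<integral>\<^sup>+x. ennreal (k x * G x) \<partial>M"
  have tangent: "ennreal (p * v powr (p - 1)) * ?H \<le> ennreal (J + (p - 1) * v powr p * I)"
    if "0 \<le> v" for v
  proof -
    have "ennreal (p * v powr (p - 1)) * ?H = (\<integral>\<^sup>+x. ennreal (p * v powr (p - 1) * (k x * G x)) \<partial>M)"
      using p nonneg by (subst nn_integral_cmult[symmetric]) (auto simp: ennreal_mult)
    also have "\<dots> \<le> (\<integral>\<^sup>+x. ennreal (k x * G x powr p) + ennreal ((p - 1) * v powr p) * ennreal (k x) \<partial>M)"
    proof (rule nn_integral_mono)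
      fix x
      have "k x * (p * v powr (p - 1) * G x) \<le> k x * (G x powr p + (p - 1) * v powr p)"
        using powr_tangent_le[OF p nonneg(2) that] nonneg(1) by (rule mult_left_mono)
      then have "ennreal (p * v powr (p - 1) * (k x * G x))
          \<le> ennreal (k x * G x powr p + (p - 1) * v powr p * k x)"
        by (intro ennreal_leI) (simp add: algebra_simps)
      then show "ennreal (p * v powr (p - 1) * (k x * G x))
          \<le> ennreal (k x * G x powr p) + ennreal ((p - 1) * v powr p) * ennreal (k x)"
        using p nonneg by (simp add: ennreal_mult)
    qed
    also have "\<dots> = (\<integral>\<^sup>+x. ennreal (k x * G x powr p) \<partial>M)
        + ennreal ((p - 1) * v powr p) * (\<integral>\<^sup>+x. ennreal (k x) \<partial>M)"
      by (simp add: nn_integral_add nn_integral_cmult)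
    also have "\<dots> \<le> ennreal J + ennreal ((p - 1) * v powr p) * ennreal I"
      using I J by (intro add_mono mult_left_mono) auto
    also have "\<dots> = ennreal (J + (p - 1) * v powr p * I)"
      using p I J by (simp flip: ennreal_mult ennreal_plus)
    finally show ?thesis .
  qed
  have "?H \<noteq> \<infinity>"
  proof
    assume "?H = \<infinity>"
    then show False
      using tangent[of 1] p by (simp add: ennreal_mult_top top_unique)
  qed
  then obtain h where h: "0 \<le> h" "?H = ennreal h"
    by (cases ?H) auto
  define v where "v = h / I"
  have v: "0 \<le> v" "h = v * I"
    using h I by (auto simp: v_def)
  have vp: "v powr (p - 1) * v = v powr p"
    using v p by (cases "v = 0") (auto simp: powr_mult_base mult.commute)
  have "p * v powr (p - 1) * h \<le> J + (p - 1) * v powr p * I"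
  proof -
    have "ennreal (p * v powr (p - 1) * h) \<le> ennreal (J + (p - 1) * v powr p * I)"
      using tangent[OF v(1)] p h by (simp add: ennreal_mult)
    moreover have "0 \<le> J + (p - 1) * v powr p * I"
      using p I J by simp
    ultimately show ?thesis
      by (simp only: ennreal_le_iff)
  qed
  then have "v powr p * I \<le> J"
    using v(2) vp by (simp add: algebra_simps)
  then have "I powr (p - 1) * (v powr p * I) \<le> I powr (p - 1) * J"
    by (intro mult_left_mono) auto
  moreover have "I powr (p - 1) * (v powr p * I) = h powr p"
  proof -
    have "I * I powr (p - 1) = I powr p"
      using I by (simp add: powr_mult_base)
    then show ?thesis
      using v I by (simp add: powr_mult algebra_simps)
  qed
  ultimately show ?thesis
    using h by auto
qed

text \<open>
  The hypothesis \<open>k \<le> 1\<close> is what allows \<open>q > p\<close>: it makes the function \<open>J\<close> from the Jensen bound not only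
  integrable but bounded, so that \<open>J powr (q / p) \<le> A powr (q / p - 1) * J\<close>. The real-valued
  function \<open>h\<close> witnesses that the image of \<open>G\<close> is finite at every point.
\<close>

lemma schur_Lp_Lq:
  fixes k :: "'a \<Rightarrow> 'b \<Rightarrow> real" and G :: "'a \<Rightarrow> real" and p q I A :: real
  assumes "sigma_finite_measure M" "sigma_finite_measure N"
    and p: "1 < p" and pq: "p \<le> q"
    and k[measurable]: "(\<lambda>(x, y). k x y) \<in> borel_measurable (M \<Otimes>\<^sub>M N)"
    and k01: "\<And>x y. 0 \<le> k x y" "\<And>x y. k x y \<le> 1"
    and I: "0 < I"
    and Ix: "\<And>y. y \<in> space N \<Longrightarrow> (\<integral>\<^sup>+x. ennreal (k x y) \<partial>M) \<le> ennreal I"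
    and Iy: "\<And>x. x \<in> space M \<Longrightarrow> (\<integral>\<^sup>+y. ennreal (k x y) \<partial>N) \<le> ennreal I"
    and G[measurable]: "G \<in> borel_measurable M" and G0: "\<And>x. 0 \<le> G x"
    and A: "0 \<le> A" "(\<integral>\<^sup>+x. ennreal (G x powr p) \<partial>M) = ennreal A"
  shows "\<exists>h. (\<forall>y\<in>space N. 0 \<le> h y \<and> (\<integral>\<^sup>+x. ennreal (k x y * G x) \<partial>M) = ennreal (h y)) \<and>
    (\<integral>\<^sup>+y. ennreal (h y powr q) \<partial>N) \<le> ennreal (I powr ((p - 1) * (q / p) + 1) * A powr (q / p))"
proof -
  interpret M: sigma_finite_measure M by fact
  interpret N: sigma_finite_measure N by fact
  interpret MN: pair_sigma_finite M N ..
  define J where "J y = (\<integral>\<^sup>+x. ennreal (k x y * G x powr p) \<partial>M)" for y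
  have J_le: "J y \<le> ennreal A" for y
    unfolding J_def A(2)[symmetric] using k01
    by (intro nn_integral_mono ennreal_leI mult_left_le_one_le) auto
  define j where "j y = enn2real (J y)" for y
  have j: "0 \<le> j y" "J y = ennreal (j y)" "j y \<le> A" for y
  proof -
    show "0 \<le> j y" by (simp add: j_def)
    show "J y = ennreal (j y)"
      unfolding j_def using J_le[of y]
      by (intro ennreal_enn2real[symmetric]) (auto simp: le_less_trans)
    then show "j y \<le> A"
      using J_le[of y] A(1) by simp
  qed
  have "\<forall>y\<in>space N. \<exists>h\<ge>0. (\<integral>\<^sup>+x. ennreal (k x y * G x) \<partial>M) = ennreal h
      \<and> h powr p \<le> I powr (p - 1) * j y"
    using p k01 G0 I Ix j unfolding J_def
    by (intro ballI nn_integral_weighted_power_mean) auto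
  then obtain h where h: "\<forall>y\<in>space N. 0 \<le> h y \<and> (\<integral>\<^sup>+x. ennreal (k x y * G x) \<partial>M) = ennreal (h y)
      \<and> h y powr p \<le> I powr (p - 1) * j y"
    by metis
  have hq: "h y powr q \<le> (I powr ((p - 1) * (q / p)) * A powr (q / p - 1)) * j y" if y: "y \<in> space N" for y
  proof -
    have "h y powr q = (h y powr p) powr (q / p)"
      using p by (simp add: powr_powr)
    also have "\<dots> \<le> (I powr (p - 1) * j y) powr (q / p)"
      using h y p pq by (intro powr_mono2) auto
    also have "\<dots> = I powr ((p - 1) * (q / p)) * (j y powr (q / p - 1) * j y)"
    proof (cases "j y = 0")
      case False
      then have "0 < j y" using j(1)[of y] by simp
      then have "j y powr (q / p - 1) * j y = j y powr (q / p)"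
        by (simp add: powr_mult_base mult.commute)
      then show ?thesis
        using I j(1)[of y] by (simp add: powr_mult powr_powr)
    qed (use p pq in auto)
    also have "\<dots> \<le> I powr ((p - 1) * (q / p)) * (A powr (q / p - 1) * j y)"
      using j[of y] p pq by (intro mult_left_mono mult_right_mono powr_mono2) auto
    finally show ?thesis by (simp add: mult.assoc)
  qed
  have "(\<integral>\<^sup>+y. J y \<partial>N) = (\<integral>\<^sup>+x. \<integral>\<^sup>+y. ennreal (k x y * G x powr p) \<partial>N \<partial>M)"
    unfolding J_def by (rule MN.Fubini') measurable
  also have "\<dots> = (\<integral>\<^sup>+x. ennreal (G x powr p) * (\<integral>\<^sup>+y. ennreal (k x y) \<partial>N) \<partial>M)"
    using k01 by (intro nn_integral_cong)
      (simp add: ennreal_mult mult.commute nn_integral_cmult[symmetric])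
  also have "\<dots> \<le> (\<integral>\<^sup>+x. ennreal (G x powr p) * ennreal I \<partial>M)"
    using Iy by (intro nn_integral_mono mult_left_mono) auto
  also have "\<dots> = ennreal (A * I)"
    using A I by (simp add: nn_integral_multc ennreal_mult)
  finally have intJ: "(\<integral>\<^sup>+y. J y \<partial>N) \<le> ennreal (A * I)" .
  let ?c = "I powr ((p - 1) * (q / p)) * A powr (q / p - 1)"
  have [measurable]: "J \<in> borel_measurable N"
    unfolding J_def by measurable
  have "(\<integral>\<^sup>+y. ennreal (h y powr q) \<partial>N) \<le> (\<integral>\<^sup>+y. ennreal ?c * J y \<partial>N)"
  proof (rule nn_integral_mono)
    fix y assume "y \<in> space N"
    then show "ennreal (h y powr q) \<le> ennreal ?c * J y"
      using hq[of y] j(1)[of y] by (simp add: j(2) flip: ennreal_mult)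
  qed
  also have "\<dots> \<le> ennreal ?c * ennreal (A * I)"
    using intJ by (simp add: nn_integral_cmult mult_left_mono)
  also have "\<dots> = ennreal (I powr ((p - 1) * (q / p) + 1) * A powr (q / p))"
  proof -
    have "A powr (q / p - 1) * A = A powr (q / p)"
      using A p pq by (cases "A = 0") (auto simp: powr_mult_base mult.commute)
    moreover have "I powr ((p - 1) * (q / p)) * I = I powr ((p - 1) * (q / p) + 1)"
      using I by (simp add: powr_add)
    ultimately have "?c * (A * I) = I powr ((p - 1) * (q / p) + 1) * A powr (q / p)"
      by (metis mult.assoc mult.left_commute mult.commute)
    then show ?thesis
      using A I by (simp flip: ennreal_mult)
  qed
  finally show ?thesis
    using h by blast
qed

section \<open>The kernel on the multiplicative group of positive reals\<close>

text \<open>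
  The Haar measure \<open>dx / x\<close> of the positive reals, as a measure on the whole line that gives the
  nonpositive half-line mass 0.
\<close>

definition haar_pos :: "real measure" where
  "haar_pos = density lborel (\<lambda>x. ennreal (indicator {0<..} x / x))"

text \<open>
  The kernel vanishes for \<open>t \<le> 0\<close>, so that its bounds hold for all real arguments.
\<close>

definition two_power_kernel :: "real \<Rightarrow> real \<Rightarrow> real \<Rightarrow> real" where
  "two_power_kernel s r t = indicator {0<..} t * min (t powr s) (t powr - r)"

lemma measurable_two_power_kernel [measurable]: "two_power_kernel s r \<in> borel_measurable borel"
  unfolding two_power_kernel_def by measurable

lemma two_power_kernel_nonneg: "0 \<le> two_power_kernel s r t"
  by (simp add: two_power_kernel_def)

lemma two_power_kernel_le_1:
  assumes "0 < s" "0 < r"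
  shows "two_power_kernel s r t \<le> 1"
proof -
  have "min (t powr s) (t powr - r) \<le> 1" if "0 < t"
  proof (cases "t \<le> 1")
    case True
    then have "t powr s \<le> 1" using assms that by (simp add: powr_le1)
    then show ?thesis by simp
  next
    case False
    then have "t powr - r \<le> t powr 0" using assms by (intro powr_mono) auto
    then show ?thesis using False by simp
  qed
  then show ?thesis
    by (auto simp: two_power_kernel_def indicator_def)
qed

lemma sets_haar_pos [measurable_cong, simp]: "sets haar_pos = sets borel"
  and space_haar_pos [simp]: "space haar_pos = UNIV"
  by (simp_all add: haar_pos_def)

lemma sigma_finite_haar_pos: "sigma_finite_measure haar_pos"
  unfolding haar_pos_def
  by (subst sigma_finite_measure.sigma_finite_iff_density_finite[OF sigma_finite_lborel]) auto

lemma nn_integral_haar_pos: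
  assumes "g \<in> borel_measurable borel"
  shows "(\<integral>\<^sup>+x. g x \<partial>haar_pos) = (\<integral>\<^sup>+x. ennreal (indicator {0<..} x / x) * g x \<partial>lborel)"
  unfolding haar_pos_def using assms by (subst nn_integral_density) auto

text \<open>
  The two summands are the integrals of \<open>t powr (s - 1)\<close> over the unit interval and of
  \<open>t powr (- r - 1)\<close> beyond 1.
\<close>

lemma nn_integral_two_power_kernel:
  assumes s: "0 < s" and r: "0 < r"
  shows "(\<integral>\<^sup>+t. ennreal (two_power_kernel s r t) \<partial>haar_pos) \<le> ennreal (1 / s + 1 / r)"
proof -
  have near0: "(\<integral>\<^sup>+t. ennreal (t powr (s - 1)) * indicator {0..1} t \<partial>lborel) = ennreal (1 / s)"
    using nn_integral_has_integral_lebesgue'[OF _ has_integral_powr_from_0[of "s - 1" 1]] s by simp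
  have "((\<lambda>t. t powr (- r - 1)) has_integral 1 / r) {1..}"
    using has_integral_powr_to_inf[of "- r - 1" 1] r by simp
  then have near_inf: "(\<integral>\<^sup>+t. ennreal (t powr (- r - 1)) * indicator {1..} t \<partial>lborel) = ennreal (1 / r)"
    by (rule nn_integral_has_integral_lebesgue'[rotated]) simp
  have "(\<integral>\<^sup>+t. ennreal (two_power_kernel s r t) \<partial>haar_pos)
      \<le> (\<integral>\<^sup>+t. ennreal (t powr (s - 1)) * indicator {0..1} t
            + ennreal (t powr (- r - 1)) * indicator {1..} t \<partial>lborel)"
    by (subst nn_integral_haar_pos, measurable, rule nn_integral_mono)
       (auto simp: two_power_kernel_def indicator_def powr_diff field_simps min_def
         intro!: ennreal_leI divide_right_mono simp flip: ennreal_mult ennreal_plus)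
  also have "\<dots> = ennreal (1 / s + 1 / r)"
    using s r near0 near_inf by (simp add: nn_integral_add)
  finally show ?thesis .
qed

lemma nn_integral_haar_pos_scale:
  fixes y :: real
  assumes [measurable]: "g \<in> borel_measurable borel" and y: "0 < y"
  shows "(\<integral>\<^sup>+x. g (y * x) \<partial>haar_pos) = (\<integral>\<^sup>+x. g x \<partial>haar_pos)"
proof -
  have "(\<integral>\<^sup>+x. g x \<partial>haar_pos) = (\<integral>\<^sup>+x. ennreal (indicator {0<..} x / x) * g x \<partial>lborel)"
    by (simp add: nn_integral_haar_pos)
  also have "\<dots> = ennreal \<bar>y\<bar> * (\<integral>\<^sup>+x. ennreal (indicator {0<..} (0 + y * x) / (0 + y * x)) * g (0 + y * x) \<partial>lborel)"
    using y by (intro nn_integral_real_affine) auto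
  also have "\<dots> = (\<integral>\<^sup>+x. ennreal \<bar>y\<bar> * (ennreal (indicator {0<..} (0 + y * x) / (0 + y * x)) * g (0 + y * x)) \<partial>lborel)"
    by (rule nn_integral_cmult[symmetric]) measurable
  also have "\<dots> = (\<integral>\<^sup>+x. ennreal (indicator {0<..} x / x) * g (y * x) \<partial>lborel)"
    using y by (intro nn_integral_cong)
      (auto simp: indicator_def zero_less_mult_iff mult.assoc[symmetric] simp flip: ennreal_mult)
  also have "\<dots> = (\<integral>\<^sup>+x. g (y * x) \<partial>haar_pos)"
    by (subst nn_integral_haar_pos) auto
  finally show ?thesis ..
qed

lemma nn_integral_two_power_kernel_scale:
  assumes s: "0 < s" and r: "0 < r"
  shows "(\<integral>\<^sup>+x. ennreal (two_power_kernel s r (x * y)) \<partial>haar_pos) \<le> ennreal (1 / s + 1 / r)"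
proof (cases "0 < y")
  case True
  then show ?thesis
    using nn_integral_haar_pos_scale[of "\<lambda>t. ennreal (two_power_kernel s r t)" y]
      nn_integral_two_power_kernel[OF assms] by (simp add: mult.commute)
next
  case False
  have "ennreal (indicator {0<..} x / x) * ennreal (two_power_kernel s r (x * y)) = 0" for x
    using False by (auto simp: two_power_kernel_def indicator_def zero_less_mult_iff)
  then show ?thesis
    by (simp add: nn_integral_haar_pos del: mult_eq_0_iff)
qed

section \<open>Norms and the operator\<close>

text \<open>
  If the integrand is not integrable, the left-hand side is 0 by convention.
\<close>

lemma norm_lebesgue_integral_le_nn_integral:
  fixes f :: "'a \<Rightarrow> 'b::{banach, second_countable_topology}"
  shows "ennreal (norm (\<integral>x. f x \<partial>M)) \<le> (\<integral>\<^sup>+x. ennreal (norm (f x)) \<partial>M)"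
  by (cases "integrable M f") (auto simp: integral_norm_bound_ennreal not_integrable_integral_eq)

lemma Lp_norm_leI:
  assumes "0 < q" "0 \<le> c"
    and le: "(\<integral>\<^sup>+x\<in>{0<..}. ennreal (norm (g x) powr q) \<partial>lebesgue) \<le> ennreal (c powr q)"
  shows "Lp_norm q g \<le> ennreal c"
proof -
  let ?I = "\<integral>\<^sup>+x\<in>{0<..}. ennreal (norm (g x) powr q) \<partial>lebesgue"
  have fin: "?I \<noteq> \<infinity>"
    using le by (metis ennreal_neq_top infinity_ennreal_def top_unique)
  have "enn2real ?I powr (1 / q) \<le> (c powr q) powr (1 / q)"
    using assms le by (intro powr_mono2 enn2real_leI) auto
  also have "\<dots> = c"
    using assms by (simp add: powr_powr)
  finally show ?thesis
    using fin by (simp add: Lp_norm_def ennreal_leI)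
qed

lemma Lp_norm_finiteE:
  assumes "Lp_norm p g \<noteq> \<infinity>"
  obtains A where "0 \<le> A" "(\<integral>\<^sup>+x\<in>{0<..}. ennreal (norm (g x) powr p) \<partial>lebesgue) = ennreal A"
    "Lp_norm p g = ennreal (A powr (1 / p))"
proof -
  let ?I = "\<integral>\<^sup>+x\<in>{0<..}. ennreal (norm (g x) powr p) \<partial>lebesgue"
  have "?I \<noteq> \<infinity>"
    using assms by (auto simp: Lp_norm_def)
  then obtain A where A: "0 \<le> A" "?I = ennreal A"
    by (cases ?I) auto
  then show ?thesis
    using that[OF A] by (simp add: Lp_norm_def)
qed


text \<open>
  The weights turn the kernel bound into a function of the product \<open>x * y\<close>. Each entry of the
  minimum is a product of powers of \<open>x\<close> and \<open>y\<close>. The relation for \<open>\<beta>\<close> equates the exponents of the first entry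
  with those of \<open>(x * y) powr s\<close>; since \<open>b1 - c1 = b2 - c2\<close>, the same relation holds with \<open>b2, c2\<close>
  in place of \<open>b1, c1\<close> and treats the second entry. The factor \<open>1 / x\<close> belongs to the Haar measure, and
  \<open>y powr - (1 / q)\<close> becomes \<open>1 / y\<close> when the \<open>q\<close>-th power is taken.
\<close>

lemma kernel_weight_identity:
  fixes b0 b1 b2 c0 c1 c2 p q \<beta> \<gamma> x y :: real
  assumes p: "1 < p" and b: "b1 - b2 = c1 - c2"
    and \<beta>: "\<beta> = \<gamma> + c0 - b0 + c1 - b1 + 1 / q - 1 / conj_exponent p"
    and x: "0 < x" and y: "0 < y"
  shows "y powr (c0 - \<beta>) * x powr b0 * min (x powr b1 * y powr c1) (x powr b2 * y powr c2)
    = y powr - (1 / q) * (x powr (1 / p + \<gamma>) / x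
        * two_power_kernel (1 / q + c0 + c1 - \<beta>) (\<beta> - (1 / q + c0 + c2)) (x * y))"
proof -
  have "1 / conj_exponent p = 1 - 1 / p"
    using p by (simp add: conj_exponent_def field_simps)
  then have \<beta>1: "\<beta> = \<gamma> + c0 - b0 + c1 - b1 + 1 / q - 1 + 1 / p"
    and \<beta>2: "\<beta> = \<gamma> + c0 - b0 + c2 - b2 + 1 / q - 1 + 1 / p"
    using \<beta> b by linarith+
  let ?A = "y powr (c0 - \<beta>) * x powr b0" and ?B = "y powr - (1 / q) * (x powr (1 / p + \<gamma>) / x)"
  have comb: "x powr u * y powr v * (x powr u' * y powr v') = x powr (u + u') * y powr (v + v')" for u v u' v'
    by (simp add: powr_add mult_ac)
  have A: "?A = x powr b0 * y powr (c0 - \<beta>)" by simp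
  have B: "?B = x powr (1 / p + \<gamma> - 1) * y powr - (1 / q)"
    using x by (simp add: powr_diff)
  have "?A * (x powr b1 * y powr c1) = ?B * (x * y) powr (1 / q + c0 + c1 - \<beta>)"
    unfolding A B using x y by (subst powr_mult) (auto simp only: comb, simp add: \<beta>1 algebra_simps)
  moreover have "?A * (x powr b2 * y powr c2) = ?B * (x * y) powr - (\<beta> - (1 / q + c0 + c2))"
    unfolding A B using x y by (subst powr_mult) (auto simp only: comb, simp add: \<beta>2 algebra_simps)
  moreover have "0 \<le> ?A" "0 \<le> ?B" using x by auto
  ultimately show ?thesis
    using x y by (simp add: two_power_kernel_def min_mult_distrib_left mult.assoc[symmetric])
qed


text \<open>
  \<open>G\<close> is only required to agree almost everywhere with the weighted modulus of \<open>f\<close>: this allows a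
  Borel function in place of a Lebesgue measurable one, so that Tonelli can be applied to products of
  Borel measures.
\<close>

lemma kernel_op_weighted_bound:
  fixes p q b0 b1 b2 c0 c1 c2 \<beta> \<gamma> C y :: real
    and K :: "real \<Rightarrow> real \<Rightarrow> complex" and f :: "real \<Rightarrow> complex"
  assumes p: "1 < p" and b: "b1 - b2 = c1 - c2"
    and \<beta>: "\<beta> = \<gamma> + c0 - b0 + c1 - b1 + 1 / q - 1 / conj_exponent p"
    and C: "0 < C" and K: "\<And>x y. 0 < x \<Longrightarrow> 0 < y \<Longrightarrow>
           norm (K x y) \<le> C * min (x powr b1 * y powr c1) (x powr b2 * y powr c2)"
    and G[measurable]: "G \<in> borel_measurable borel" and G0: "\<And>x. 0 \<le> G x"
    and G_eq: "AE x in lborel. 0 < x \<longrightarrow> G x = x powr (1 / p + \<gamma>) * norm (f x)"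
    and y: "0 < y"
  shows "ennreal (norm (of_real (y powr - \<beta>) * kernel_op b0 c0 K f y))
    \<le> ennreal (C * y powr - (1 / q)) * (\<integral>\<^sup>+x. ennreal (two_power_kernel
        (1 / q + c0 + c1 - \<beta>) (\<beta> - (1 / q + c0 + c2)) (x * y) * G x) \<partial>haar_pos)"
    (is "?L \<le> ennreal (C * ?Y) * (\<integral>\<^sup>+x. ennreal (?\<phi> x * G x) \<partial>haar_pos)")
proof -
  let ?F = "\<lambda>x. indicator {0<..} x *\<^sub>R (of_real (x powr b0) * f x * K x y)"
  have "norm (of_real (y powr - \<beta>) * kernel_op b0 c0 K f y)
      = y powr (c0 - \<beta>) * norm (\<integral>x. ?F x \<partial>lebesgue)"
  proof -
    have "y powr (c0 - \<beta>) = y powr - \<beta> * y powr c0"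
      by (simp flip: powr_add)
    then show ?thesis
      by (simp add: kernel_op_def set_lebesgue_integral_def norm_mult)
  qed
  then have "?L = ennreal (y powr (c0 - \<beta>)) * ennreal (norm (\<integral>x. ?F x \<partial>lebesgue))"
    by (simp add: ennreal_mult)
  also have "\<dots> \<le> ennreal (y powr (c0 - \<beta>)) * (\<integral>\<^sup>+x. ennreal (norm (?F x)) \<partial>lborel)"
    using norm_lebesgue_integral_le_nn_integral[of lebesgue ?F]
    by (intro mult_left_mono) (auto simp: nn_integral_completion)
  also have "(\<integral>\<^sup>+x. ennreal (norm (?F x)) \<partial>lborel)
      \<le> (\<integral>\<^sup>+x. ennreal (C * (y powr (\<beta> - c0) * ?Y)) * (ennreal (indicator {0<..} x / x) * ennreal (?\<phi> x * G x)) \<partial>lborel)"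
  proof (rule nn_integral_mono_AE)
    show "AE x in lborel. ennreal (norm (?F x))
      \<le> ennreal (C * (y powr (\<beta> - c0) * ?Y)) * (ennreal (indicator {0<..} x / x) * ennreal (?\<phi> x * G x))"
      using G_eq
    proof eventually_elim
      case (elim x)
      show ?case
      proof (cases "0 < x")
        case True
        \<comment> \<open>The factors \<open>y powr (\<beta> - c0)\<close> and \<open>y powr (c0 - \<beta>)\<close> cancel; they are inserted to match the
            left-hand side of the weight identity.\<close>
        let ?m = "min (x powr b1 * y powr c1) (x powr b2 * y powr c2)"
        have "norm (?F x) = x powr b0 * norm (f x) * norm (K x y)"
          using True by (simp add: norm_mult)
        also have "\<dots> \<le> x powr b0 * norm (f x) * (C * ?m)"
          using K[OF True y] by (intro mult_left_mono) auto
        also have "\<dots> = C * norm (f x) * y powr (\<beta> - c0) * (y powr (c0 - \<beta>) * x powr b0 * ?m)"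
        proof -
          have "y powr (\<beta> - c0) * y powr (c0 - \<beta>) = 1"
            using y by (simp flip: powr_add)
          then show ?thesis by (simp add: algebra_simps)
        qed
        also have "\<dots> = C * (y powr (\<beta> - c0) * ?Y) * (1 / x * (?\<phi> x * G x))"
          unfolding kernel_weight_identity[OF p b \<beta> True y] using elim True by (simp add: mult_ac)
        finally show ?thesis
          using True C y G0 two_power_kernel_nonneg
          by (simp add: ennreal_leI flip: ennreal_mult)
      qed simp
    qed
  qed
  also have "\<dots> = ennreal (C * (y powr (\<beta> - c0) * ?Y)) * (\<integral>\<^sup>+x. ennreal (?\<phi> x * G x) \<partial>haar_pos)"
    by (subst nn_integral_cmult) (auto simp: nn_integral_haar_pos)
  finally have "?L \<le> ennreal (y powr (c0 - \<beta>)) * (ennreal (C * (y powr (\<beta> - c0) * ?Y))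
      * (\<integral>\<^sup>+x. ennreal (?\<phi> x * G x) \<partial>haar_pos))"
    by (simp add: mult_left_mono)
  also have "\<dots> = ennreal (y powr (c0 - \<beta>) * (C * (y powr (\<beta> - c0) * ?Y))) * (\<integral>\<^sup>+x. ennreal (?\<phi> x * G x) \<partial>haar_pos)"
    using C by (simp add: ennreal_mult mult.assoc)
  also have "y powr (c0 - \<beta>) * (C * (y powr (\<beta> - c0) * ?Y)) = C * ?Y"
  proof -
    have "y powr (c0 - \<beta>) * y powr (\<beta> - c0) = 1"
      using y by (simp flip: powr_add)
    then show ?thesis by (simp add: algebra_simps)
  qed
  finally show ?thesis .
qed

theorem corollary1p6:
  fixes p q b0 b1 b2 c0 c1 c2 \<beta> \<gamma> :: real
    and K :: "real \<Rightarrow> real \<Rightarrow> complex"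
  assumes "1 < p" and "p \<le> q"
    and "b1 - b2 = c1 - c2" and "c1 - c2 > 0"
    and "set_borel_measurable lebesgue ({0<..} \<times> {0<..}) (\<lambda>(x, y). K x y)"
    and "\<exists>C>0. \<forall>x>0. \<forall>y>0.
           norm (K x y) \<le> C * min (x powr b1 * y powr c1) (x powr b2 * y powr c2)"
    and "\<beta> = \<gamma> + c0 - b0 + c1 - b1 + 1 / q - 1 / conj_exponent p"
    and "1 / q + c0 + c2 < \<beta>" and "\<beta> < 1 / q + c0 + c1"
  shows "\<exists>C>0. \<forall>f. admissible b0 b1 b2 f \<longrightarrow>
           Lp_norm q (\<lambda>y. of_real (y powr - \<beta>) * kernel_op b0 c0 K f y)
             \<le> ennreal C * Lp_norm p (\<lambda>x. of_real (x powr \<gamma>) * f x)"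
proof -
  obtain C where C: "0 < C" and K: "\<And>x y. 0 < x \<Longrightarrow> 0 < y \<Longrightarrow>
      norm (K x y) \<le> C * min (x powr b1 * y powr c1) (x powr b2 * y powr c2)"
    using assms(6) by blast
  define s where "s = 1 / q + c0 + c1 - \<beta>"
  define r where "r = \<beta> - (1 / q + c0 + c2)"
  \<comment> \<open>\<open>I\<close> is the integral of the kernel against the Haar measure; the exponent in \<open>D\<close> below is the one
      from the Schur test, divided by \<open>q\<close> for the \<open>q\<close>-th root.\<close>
  define I where "I = 1 / s + 1 / r"
  have s: "0 < s" and r: "0 < r"
    using assms(8,9) by (auto simp: s_def r_def)
  then have I: "0 < I"
    by (simp add: I_def add_pos_pos)
  have p: "1 < p" and q: "0 < q"
    using assms(1,2) by auto
  define D where "D = C * I powr (((p - 1) * (q / p) + 1) / q)"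
  have D: "0 < D"
    using C I by (simp add: D_def)
  have "Lp_norm q (\<lambda>y. of_real (y powr - \<beta>) * kernel_op b0 c0 K f y)
      \<le> ennreal D * Lp_norm p (\<lambda>x. of_real (x powr \<gamma>) * f x)"
    if f: "admissible b0 b1 b2 f" for f
  proof (cases "Lp_norm p (\<lambda>x. of_real (x powr \<gamma>) * f x) = \<infinity>")
    case True
    then show ?thesis
      using D by (simp add: ennreal_mult_top)
  next
    case False
    then obtain A where A: "0 \<le> A"
        "(\<integral>\<^sup>+x\<in>{0<..}. ennreal (norm (of_real (x powr \<gamma>) * f x) powr p) \<partial>lebesgue) = ennreal A"
        "Lp_norm p (\<lambda>x. of_real (x powr \<gamma>) * f x) = ennreal (A powr (1 / p))"
      by (rule Lp_norm_finiteE)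
    \<comment> \<open>\<open>f\<close> is Lebesgue measurable; \<open>G\<close> is a Borel version of its weighted modulus, nonnegative everywhere.\<close>
    obtain G where G[measurable]: "G \<in> borel_measurable borel" and G0: "\<And>x. 0 \<le> G x"
      and G_eq: "AE x in lborel. 0 < x \<longrightarrow> G x = x powr (1 / p + \<gamma>) * norm (f x)"
    proof -
      have [measurable]: "(\<lambda>x. indicator {0<..} x *\<^sub>R f x) \<in> borel_measurable lebesgue"
        using f by (simp add: admissible_def set_borel_measurable_def)
      have [measurable]: "(\<lambda>x::real. x powr (1 / p + \<gamma>)) \<in> borel_measurable lebesgue"
        by (intro measurable_completion) measurable
      have "(\<lambda>x. x powr (1 / p + \<gamma>) * norm (indicator {0<..} x *\<^sub>R f x)) \<in> borel_measurable lebesgue"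
        by measurable
      then obtain g where g: "g \<in> borel_measurable lborel"
        "AE x in lborel. x powr (1 / p + \<gamma>) * norm (indicator {0<..} x *\<^sub>R f x) = g x"
        using completion_ex_borel_measurable_real by blast
      show ?thesis
      proof (rule that[of "\<lambda>x. \<bar>g x\<bar>"])
        show "AE x in lborel. 0 < x \<longrightarrow> \<bar>g x\<bar> = x powr (1 / p + \<gamma>) * norm (f x)"
          using g(2)
        proof eventually_elim
          case (elim x)
          show ?case by (simp flip: elim)
        qed
      qed (use g(1) in auto)
    qed
    have GA: "(\<integral>\<^sup>+x. ennreal (G x powr p) \<partial>haar_pos) = ennreal A"
    proof -
      have "(\<integral>\<^sup>+x. ennreal (G x powr p) \<partial>haar_pos)
          = (\<integral>\<^sup>+x. ennreal (norm (of_real (x powr \<gamma>) * f x) powr p) * indicator {0<..} x \<partial>lborel)"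
        using G_eq
      proof (subst nn_integral_haar_pos, simp, intro nn_integral_cong_AE, eventually_elim)
        fix x assume elim: "0 < x \<longrightarrow> G x = x powr (1 / p + \<gamma>) * norm (f x)"
        show "ennreal (indicator {0<..} x / x) * ennreal (G x powr p)
            = ennreal (norm (of_real (x powr \<gamma>) * f x) powr p) * indicator {0<..} x"
        proof (cases "0 < x")
          case True
          have "(x powr (1 / p + \<gamma>) * norm (f x)) powr p = x * (x powr \<gamma> * norm (f x)) powr p"
          proof -
            have "(1 / p + \<gamma>) * p = 1 + \<gamma> * p"
              using p by (simp add: field_simps)
            then show ?thesis
              using True p by (simp add: powr_mult powr_powr powr_add)
          qed
          then show ?thesis
            using elim True by (simp add: norm_mult flip: ennreal_mult)
        qed simp
      qed
      then show ?thesis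
        using A(2) by (simp add: nn_integral_completion)
    qed
    let ?k = "\<lambda>x y. two_power_kernel s r (x * y)"
    have "\<exists>h. (\<forall>y\<in>space haar_pos. 0 \<le> h y \<and> (\<integral>\<^sup>+x. ennreal (?k x y * G x) \<partial>haar_pos) = ennreal (h y)) \<and>
      (\<integral>\<^sup>+y. ennreal (h y powr q) \<partial>haar_pos) \<le> ennreal (I powr ((p - 1) * (q / p) + 1) * A powr (q / p))"
    proof (rule schur_Lp_Lq)
      show "(\<lambda>(x, y). ?k x y) \<in> borel_measurable (haar_pos \<Otimes>\<^sub>M haar_pos)"
        by measurable
      show "(\<integral>\<^sup>+x. ennreal (?k x y) \<partial>haar_pos) \<le> ennreal I" for y
        unfolding I_def using s r by (rule nn_integral_two_power_kernel_scale)
      show "(\<integral>\<^sup>+y. ennreal (?k x y) \<partial>haar_pos) \<le> ennreal I" for x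
        unfolding I_def using nn_integral_two_power_kernel_scale[OF s r, of x] by (simp add: mult.commute)
    qed (use assms(1,2) s r I A GA G0 sigma_finite_haar_pos two_power_kernel_nonneg two_power_kernel_le_1 in auto)
    then obtain h where h: "\<And>y. 0 \<le> h y" "\<And>y. (\<integral>\<^sup>+x. ennreal (?k x y * G x) \<partial>haar_pos) = ennreal (h y)"
      and hq: "(\<integral>\<^sup>+y. ennreal (h y powr q) \<partial>haar_pos) \<le> ennreal (I powr ((p - 1) * (q / p) + 1) * A powr (q / p))"
      by auto
    have h_meas[measurable]: "h \<in> borel_measurable borel"
    proof -
      have "(\<lambda>y. \<integral>\<^sup>+x. ennreal (?k x y * G x) \<partial>haar_pos) \<in> borel_measurable borel"
        using sigma_finite_haar_pos by (intro sigma_finite_measure.borel_measurable_nn_integral) measurable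
      then have "(\<lambda>y. enn2real (ennreal (h y))) \<in> borel_measurable borel"
        unfolding h(2) by measurable
      then show ?thesis using h(1) by simp
    qed
    have "Lp_norm q (\<lambda>y. of_real (y powr - \<beta>) * kernel_op b0 c0 K f y) \<le> ennreal (D * A powr (1 / p))"
    proof (rule Lp_norm_leI[OF q])
      let ?T = "\<lambda>y. of_real (y powr - \<beta>) * kernel_op b0 c0 K f y"
      have T: "norm (?T y) powr q \<le> C powr q * (1 / y * h y powr q)" if y: "0 < y" for y
      proof -
        have "ennreal (norm (?T y)) \<le> ennreal (C * y powr - (1 / q)) * ennreal (h y)"
          using kernel_op_weighted_bound[OF p assms(3,7) C K G G0 G_eq y]
          unfolding h(2)[of y, unfolded s_def r_def] .
        then have "norm (?T y) \<le> C * y powr - (1 / q) * h y"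
          using C h(1)[of y] by (simp flip: ennreal_mult)
        then have "norm (?T y) powr q \<le> (C * y powr - (1 / q) * h y) powr q"
          using q by (intro powr_mono2) auto
        also have "\<dots> = C powr q * (1 / y * h y powr q)"
        proof -
          have "(y powr - (1 / q)) powr q = y powr - 1"
            using q by (simp only: powr_powr) simp
          then have "(y powr - (1 / q)) powr q = 1 / y"
            using y by (simp add: powr_minus_divide)
          then show ?thesis
            using C h(1)[of y] by (simp add: powr_mult)
        qed
        finally show ?thesis .
      qed
      have "(\<integral>\<^sup>+y\<in>{0<..}. ennreal (norm (?T y) powr q) \<partial>lebesgue)
          \<le> (\<integral>\<^sup>+y. ennreal (C powr q) * (ennreal (indicator {0<..} y / y) * ennreal (h y powr q)) \<partial>lborel)"
        unfolding nn_integral_completion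
        using T by (intro nn_integral_mono) (auto simp: indicator_def ennreal_leI simp flip: ennreal_mult)
      also have "\<dots> = ennreal (C powr q) * (\<integral>\<^sup>+y. ennreal (h y powr q) \<partial>haar_pos)"
        by (simp add: nn_integral_cmult nn_integral_haar_pos)
      also have "\<dots> \<le> ennreal (C powr q) * ennreal (I powr ((p - 1) * (q / p) + 1) * A powr (q / p))"
        using hq by (rule mult_left_mono) simp
      also have "\<dots> = ennreal ((D * A powr (1 / p)) powr q)"
        using C I A q by (simp add: D_def powr_mult powr_powr mult.assoc flip: ennreal_mult)
      finally show "(\<integral>\<^sup>+y\<in>{0<..}. ennreal (norm (?T y) powr q) \<partial>lebesgue)
          \<le> ennreal ((D * A powr (1 / p)) powr q)" .
    qed (use D in auto)
    then show ?thesis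
      using D A(3) by (simp add: ennreal_mult)
  qed
  then show ?thesis
    using D by blast
qed

end
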